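(* Let $\mathcal{C}$ be a small category, let $\mathbf{G}$ be a presheaf on $\mathcal{C}$ (a contravariant functor from $\mathcal{C}$ to $\mathrm{Set}$), and let $\mathbf{\Omega}$ be the presheaf of sieves on $\mathcal{C}$. Let $\nu$ be a sieve-valued valuation on $\mathbf{G}$, i.e. a function assigning to each object $A$ of $\mathcal{C}$ and each $d\in\mathbf{G}(A)$ a sieve $\nu(A,d)$ on $A$. Then $\nu$ obeys FUNC, i.e. $$\nu(B,\mathbf{G}(f)(d)) = f^*(\nu(A,d))$$ for all objects $A,B$ of $\mathcal{C}$, all morphisms $f:B\rightarrow A$ and all $d\in\mathbf{G}(A)$, if and only if the functions $N^\nu_A:\mathbf{G}(A)\rightarrow\mathbf{\Omega}(A)$, defined for each object $A$ of $\mathcal{C}$ by $$N^\nu_A(d):=\nu(A,d),$$ are the components of a natural transformation $N^\nu$ from $\mathbf{G}$ to $\mathbf{\Omega}$.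
   Context: A sieve on an object $A$ of $\mathcal{C}$ is a collection $S$ of morphisms in $\mathcal{C}$ with codomain $A$ such that if $f:B\rightarrow A$ belongs to $S$ and $g:C\rightarrow B$ is any morphism of $\mathcal{C}$, then $f\circ g:C\rightarrow A$ also belongs to $S$. For a sieve $S$ on $A$ and a morphism $f:B\rightarrow A$, the pull-back of $S$ to $B$ by $f$ is the sieve on $B$ given by $f^*(S):=\{h:C\rightarrow B\mid f\circ h\in S\}$. The presheaf $\mathbf{\Omega}$ on $\mathcal{C}$ (the subobject classifier of the topos $\mathrm{Set}^{\mathcal{C}^{\mathrm{op}}}$) is defined by: $\mathbf{\Omega}(A)$ is the set of all sieves on $A$; and for $f:B\rightarrow A$, the map $\mathbf{\Omega}(f):\mathbf{\Omega}(A)\rightarrow\mathbf{\Omega}(B)$ is $\mathbf{\Omega}(f)(S):=f^*(S)$. A natural transformation $N:\mathbf{X}\rightarrow\mathbf{Y}$ between presheaves on $\mathcal{C}$ is a family of maps $N_A:\mathbf{X}(A)\rightarrow\mathbf{Y}(A)$, one for each object $A$, such that for every morphism $f:B\rightarrow A$ one has $\mathbf{Y}(f)\circ N_A=N_B\circ\mathbf{X}(f)$. *)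

theory Defs
  imports "HOL-Library.FuncSet"
begin

text \<open>
  The carriers \<open>Obj\<close> and \<open>Arr\<close> are sets, so every category below is small. The fields are only
  constrained on the carriers; \<open>Comp C f g\<close> is \<open>f \<circ> g\<close> (first \<open>g\<close>, then \<open>f\<close>).
\<close>

record ('o, 'm) cat_data =
  Obj :: "'o set"
  Arr :: "'m set"
  Dom :: "'m \<Rightarrow> 'o"
  Cod :: "'m \<Rightarrow> 'o"
  Id :: "'o \<Rightarrow> 'm"
  Comp :: "'m \<Rightarrow> 'm \<Rightarrow> 'm"

definition Hom :: "('o, 'm) cat_data \<Rightarrow> 'o \<Rightarrow> 'o \<Rightarrow> 'm set" where
  "Hom C B A = {f \<in> Arr C. Dom C f = B \<and> Cod C f = A}"

locale small_category =
  fixes C :: "('o, 'm) cat_data"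
  assumes Dom_in_Obj: "f \<in> Arr C \<Longrightarrow> Dom C f \<in> Obj C"
    and Cod_in_Obj: "f \<in> Arr C \<Longrightarrow> Cod C f \<in> Obj C"
    and Id_in_Hom: "A \<in> Obj C \<Longrightarrow> Id C A \<in> Hom C A A"
    and Comp_in_Hom: "f \<in> Hom C B A \<Longrightarrow> g \<in> Hom C D B \<Longrightarrow> Comp C f g \<in> Hom C D A"
    and Comp_Id: "f \<in> Hom C B A \<Longrightarrow> Comp C f (Id C B) = f"
    and Id_Comp: "f \<in> Hom C B A \<Longrightarrow> Comp C (Id C A) f = f"
    and Comp_assoc: "f \<in> Hom C B A \<Longrightarrow> g \<in> Hom C D B \<Longrightarrow> h \<in> Hom C E D \<Longrightarrow>
      Comp C (Comp C f g) h = Comp C f (Comp C g h)"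

text \<open>
  All sets \<open>X(A)\<close> are subsets of one type; they need not be disjoint, and may be empty.
  The map \<open>X(f) : X(A) \<rightarrow> X(B)\<close> of \<open>f : B \<rightarrow> A\<close> is only relevant on \<open>X(A)\<close>.
\<close>

record ('o, 'm, 'x) presheaf_data =
  on_obj :: "'o \<Rightarrow> 'x set"
  on_arr :: "'m \<Rightarrow> 'x \<Rightarrow> 'x"

locale presheaf = small_category C
  for C :: "('o, 'm) cat_data" +
  fixes X :: "('o, 'm, 'x) presheaf_data"
  assumes on_arr_maps: "f \<in> Hom C B A \<Longrightarrow> on_arr X f \<in> on_obj X A \<rightarrow> on_obj X B"
    and on_arr_Id: "A \<in> Obj C \<Longrightarrow> x \<in> on_obj X A \<Longrightarrow> on_arr X (Id C A) x = x"
    and on_arr_Comp: "f \<in> Hom C B A \<Longrightarrow> g \<in> Hom C D B \<Longrightarrow> x \<in> on_obj X A \<Longrightarrow>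
      on_arr X (Comp C f g) x = on_arr X g (on_arr X f x)"

text \<open>\<open>compose S g f\<close> is the composite \<open>g \<circ> f\<close> of maps of sets, \<open>f\<close> having domain \<open>S\<close>.\<close>

locale natural_transformation = X: presheaf C X + Y: presheaf C Y
  for C :: "('o, 'm) cat_data"
    and X :: "('o, 'm, 'x) presheaf_data"
    and Y :: "('o, 'm, 'y) presheaf_data" +
  fixes N :: "'o \<Rightarrow> 'x \<Rightarrow> 'y"
  assumes component_maps: "A \<in> Obj C \<Longrightarrow> N A \<in> on_obj X A \<rightarrow> on_obj Y A"
    and naturality: "A \<in> Obj C \<Longrightarrow> B \<in> Obj C \<Longrightarrow> f \<in> Hom C B A \<Longrightarrow>
      compose (on_obj X A) (on_arr Y f) (N A) = compose (on_obj X A) (N B) (on_arr X f)"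

definition sieve_on :: "('o, 'm) cat_data \<Rightarrow> 'o \<Rightarrow> 'm set \<Rightarrow> bool" where
  "sieve_on C A S \<longleftrightarrow>
    S \<subseteq> {f \<in> Arr C. Cod C f = A} \<and>
    (\<forall>f \<in> S. \<forall>g \<in> Arr C. Cod C g = Dom C f \<longrightarrow> Comp C f g \<in> S)"

definition pullback_sieve :: "('o, 'm) cat_data \<Rightarrow> 'm \<Rightarrow> 'm set \<Rightarrow> 'm set" where
  "pullback_sieve C f S = {h \<in> Arr C. Cod C h = Dom C f \<and> Comp C f h \<in> S}"

definition Omega :: "('o, 'm) cat_data \<Rightarrow> ('o, 'm, 'm set) presheaf_data" where
  "Omega C = \<lparr>on_obj = \<lambda>A. {S. sieve_on C A S}, on_arr = pullback_sieve C\<rparr>"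

definition sieve_valued_valuation ::
    "('o, 'm) cat_data \<Rightarrow> ('o, 'm, 'x) presheaf_data \<Rightarrow> ('o \<Rightarrow> 'x \<Rightarrow> 'm set) \<Rightarrow> bool" where
  "sieve_valued_valuation C G \<nu> \<longleftrightarrow>
    (\<forall>A \<in> Obj C. \<forall>d \<in> on_obj G A. sieve_on C A (\<nu> A d))"

definition obeys_FUNC ::
    "('o, 'm) cat_data \<Rightarrow> ('o, 'm, 'x) presheaf_data \<Rightarrow> ('o \<Rightarrow> 'x \<Rightarrow> 'm set) \<Rightarrow> bool" where
  "obeys_FUNC C G \<nu> \<longleftrightarrow>
    (\<forall>A \<in> Obj C. \<forall>B \<in> Obj C. \<forall>f \<in> Hom C B A. \<forall>d \<in> on_obj G A.
      \<nu> B (on_arr G f d) = pullback_sieve C f (\<nu> A d))"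

definition valuation_map ::
    "('o, 'm, 'x) presheaf_data \<Rightarrow> ('o \<Rightarrow> 'x \<Rightarrow> 'm set) \<Rightarrow> 'o \<Rightarrow> 'x \<Rightarrow> 'm set" where
  "valuation_map G \<nu> A = (\<lambda>d \<in> on_obj G A. \<nu> A d)"

end

theory Submission
  imports Defs
begin

text \<open>Evaluated at an element \<open>d\<close> of \<open>on_obj G A\<close>, the naturality
  square of an arrow from \<open>B\<close> to \<open>A\<close> is exactly the FUNC equation for that
  arrow and \<open>d\<close>. That the components take values in \<open>Omega C\<close> is the
  hypothesis that the valuation is sieve-valued. What remains is \<open>presheaf_Omega\<close>:
  pulling back preserves sieves and is contravariantly functorial, by the unit and associativity
  laws of the category.\<close>

context small_category
begin

lemma sieve_on_pullback_sieve:
  assumes f: "f \<in> Hom C B A" and S: "sieve_on C A S"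
  shows "sieve_on C B (pullback_sieve C f S)"
proof -
  have "Comp C h g \<in> pullback_sieve C f S"
    if h: "h \<in> pullback_sieve C f S" and g: "g \<in> Arr C" "Cod C g = Dom C h" for h g
  proof -
    have h': "h \<in> Hom C (Dom C h) B" and fh: "Comp C f h \<in> S"
      using h f by (auto simp: pullback_sieve_def Hom_def)
    have g': "g \<in> Hom C (Dom C g) (Dom C h)"
      using g by (simp add: Hom_def)
    \<comment> \<open>Closure of \<open>S\<close> applies to \<open>Comp C f h\<close> only once
      \<open>g\<close> is known to be composable with it, not merely with \<open>h\<close>.\<close>
    have "Dom C (Comp C f h) = Dom C h"
      using Comp_in_Hom[OF f h'] by (simp add: Hom_def)
    then have "Comp C (Comp C f h) g \<in> S"
      using S fh g by (simp add: sieve_on_def)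
    then show ?thesis
      using Comp_assoc[OF f h' g'] Comp_in_Hom[OF h' g'] f
      by (simp add: pullback_sieve_def Hom_def)
  qed
  then show ?thesis
    using f by (auto simp: sieve_on_def pullback_sieve_def Hom_def)
qed

lemma pullback_sieve_Id:
  assumes "A \<in> Obj C" and S: "sieve_on C A S"
  shows "pullback_sieve C (Id C A) S = S"
proof -
  have "Comp C (Id C A) h = h" if "h \<in> Arr C" "Cod C h = A" for h
    using that Id_Comp[of h "Dom C h" A] by (simp add: Hom_def)
  then show ?thesis
    using S Id_in_Hom[OF assms(1)] by (auto simp: pullback_sieve_def sieve_on_def Hom_def)
qed

text \<open>Associativity turns one membership test into the other, for any set \<open>S\<close> of
  arrows.\<close>

lemma pullback_sieve_Comp:
  assumes f: "f \<in> Hom C B A" and g: "g \<in> Hom C D B"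
  shows "pullback_sieve C (Comp C f g) S = pullback_sieve C g (pullback_sieve C f S)"
proof -
  \<comment> \<open>The second conjunct supplies the typing condition hidden in membership of
    \<open>Comp C g h\<close> in the pullback along \<open>f\<close>.\<close>
  have "Comp C (Comp C f g) h = Comp C f (Comp C g h) \<and> Comp C g h \<in> Hom C (Dom C h) B"
    if "h \<in> Arr C" "Cod C h = D" for h
    using that Comp_assoc[OF f g, of h "Dom C h"] Comp_in_Hom[OF g, of h "Dom C h"]
    by (simp add: Hom_def)
  then show ?thesis
    using f g Comp_in_Hom[OF f g] by (auto simp: pullback_sieve_def Hom_def)
qed

lemma presheaf_Omega: "presheaf C (Omega C)"
  by unfold_locales
    (auto simp: Omega_def pullback_sieve_Id pullback_sieve_Comp intro: sieve_on_pullback_sieve)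

end

theorem theorem4p1:
  fixes C :: "('o, 'm) cat_data"
    and G :: "('o, 'm, 'x) presheaf_data"
    and \<nu> :: "'o \<Rightarrow> 'x \<Rightarrow> 'm set"
  assumes "small_category C"
    and "presheaf C G"
    and "sieve_valued_valuation C G \<nu>"
  shows "obeys_FUNC C G \<nu> \<longleftrightarrow>
    natural_transformation C G (Omega C) (valuation_map G \<nu>)"
proof -
  interpret presheaf C G by fact
  have maps: "valuation_map G \<nu> A \<in> on_obj G A \<rightarrow> on_obj (Omega C) A" if "A \<in> Obj C" for A
    using assms(3) that by (simp add: sieve_valued_valuation_def valuation_map_def Omega_def)
  \<comment> \<open>Both composites are \<open>undefined\<close> off \<open>on_obj G A\<close>, so
    they are equal iff they agree on that set. There \<open>on_arr_maps\<close> puts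
    \<open>on_arr G f d\<close> in \<open>on_obj G B\<close>, where the restricted function
    \<open>valuation_map G \<nu> B\<close> agrees with \<open>\<nu> B\<close>.\<close>
  have square: "compose (on_obj G A) (on_arr (Omega C) f) (valuation_map G \<nu> A) =
        compose (on_obj G A) (valuation_map G \<nu> B) (on_arr G f) \<longleftrightarrow>
      (\<forall>d \<in> on_obj G A. \<nu> B (on_arr G f d) = pullback_sieve C f (\<nu> A d))"
    if "f \<in> Hom C B A" for A B f
    using on_arr_maps[OF that]
    by (auto simp: fun_eq_iff compose_def valuation_map_def Omega_def Pi_iff)
  \<comment> \<open>The locale predicate also demands that source and target be presheaves and that
    components map correctly; these hold already, leaving only the squares.\<close>
  have "natural_transformation C G (Omega C) (valuation_map G \<nu>) \<longleftrightarrow>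
      (\<forall>A \<in> Obj C. \<forall>B \<in> Obj C. \<forall>f \<in> Hom C B A.
        compose (on_obj G A) (on_arr (Omega C) f) (valuation_map G \<nu> A) =
        compose (on_obj G A) (valuation_map G \<nu> B) (on_arr G f))"
    using assms(2) presheaf_Omega maps
    by (auto simp: natural_transformation_def natural_transformation_axioms_def)
  then show ?thesis
    by (simp add: obeys_FUNC_def square)
qed

end
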